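(* The space $C_{\bar n}\langle\mathbb R_\bullet\rangle$ has the same cellulation as the Coxeter complex $\mathcal C B_n$, and the space $C_{\bar n}\langle\mathbb R_\circ\rangle$ has the same cellulation as the Coxeter complex $\mathcal C D_n$.
   Context: $C_{\bar n}(\mathbb R_\bullet)=\mathbb R^n\setminus\{(x_1,\dots,x_n): \exists\, i\neq j,\ x_i=\pm x_j,\ \text{or } \exists\, i,\ x_i=0\}$ is the configuration space of $n$ pairs $\{x_i,-x_i\}$ of symmetric labeled particles on the line with a fixed particle at the origin. $C_{\bar n}(\mathbb R_\circ)=\mathbb R^n\setminus\{(x_1,\dots,x_n):\exists\, i\ne j,\ x_i=\pm x_j\}$ is the configuration space of $n$ pairs of symmetric labeled particles with no fixed particle at the origin (so $x_i$ and $-x_i$ may both occupy the origin). $\mathrm{Aff}(\bar{\mathbb R})$ is the group of transformations of $\mathbb R$ generated by positive scalings, acting on these spaces diagonally. $C_{\bar n}\langle\mathbb R_\bullet\rangle$ and $C_{\bar n}\langle\mathbb R_\circ\rangle$ are the spaces obtained from $C_{\bar n}(\mathbb R_\bullet)/\mathrm{Aff}(\bar{\mathbb R})$ and $C_{\bar n}(\mathbb R_\circ)/\mathrm{Aff}(\bar{\mathbb R})$ by allowing particles to collide (i.e. putting back the removed hyperplanes, so that the space is $(\mathbb R^n\setminus\{0\})/\mathbb R_{>0}$), cellulated by the loci of collisions. The Coxeter complex $\mathcal C W$ of a spherical Coxeter group is the unit sphere with the cellulation cut out by the reflecting hyperplanes of $W$: for $B_n$ the hyperplanes $x_i=0$ and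 $x_i=\pm x_j$ ($i\ne j$) in $\mathbb R^n$; for $D_n$ the hyperplanes $x_i=\pm x_j$ ($i\neq j$) in $\mathbb R^n$. *)

theory Defs
  imports "HOL-Analysis.Analysis"
begin

section \<open>Cellulated spaces\<close>

definition quotient_topology :: "'a topology \<Rightarrow> ('a \<Rightarrow> 'b) \<Rightarrow> 'b topology" where
  "quotient_topology X f =
     topology (\<lambda>U. U \<subseteq> f ` topspace X \<and> openin X {x \<in> topspace X. f x \<in> U})"

lemma openin_quotient_topology:
  "openin (quotient_topology X f) U \<longleftrightarrow>
     U \<subseteq> f ` topspace X \<and> openin X {x \<in> topspace X. f x \<in> U}"
proof -
  have "istopology (\<lambda>U. U \<subseteq> f ` topspace X \<and> openin X {x \<in> topspace X. f x \<in> U})"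
    unfolding istopology_def
  proof (intro conjI allI impI)
    fix S T
    assume "S \<subseteq> f ` topspace X \<and> openin X {x \<in> topspace X. f x \<in> S}"
      and "T \<subseteq> f ` topspace X \<and> openin X {x \<in> topspace X. f x \<in> T}"
    moreover have "{x \<in> topspace X. f x \<in> S \<inter> T} =
        {x \<in> topspace X. f x \<in> S} \<inter> {x \<in> topspace X. f x \<in> T}" by auto
    ultimately show "S \<inter> T \<subseteq> f ` topspace X" "openin X {x \<in> topspace X. f x \<in> S \<inter> T}"
      by auto
  next
    fix K
    assume K: "\<forall>S\<in>K. S \<subseteq> f ` topspace X \<and> openin X {x \<in> topspace X. f x \<in> S}"
    then show "\<Union>K \<subseteq> f ` topspace X" by blast
    have "{x \<in> topspace X. f x \<in> \<Union>K} = \<Union>((\<lambda>S. {x \<in> topspace X. f x \<in> S}) ` K)" by auto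
    with K show "openin X {x \<in> topspace X. f x \<in> \<Union>K}" by auto
  qed
  then show ?thesis unfolding quotient_topology_def by simp
qed

lemma topspace_quotient_topology: "topspace (quotient_topology X f) = f ` topspace X"
proof -
  have "{x \<in> topspace X. f x \<in> f ` topspace X} = topspace X" by auto
  then have "openin (quotient_topology X f) (f ` topspace X)"
    by (simp add: openin_quotient_topology)
  then have "f ` topspace X \<subseteq> topspace (quotient_topology X f)" by (rule openin_subset)
  moreover have "topspace (quotient_topology X f) \<subseteq> f ` topspace X"
    using openin_topspace[of "quotient_topology X f"] unfolding openin_quotient_topology by blast
  ultimately show ?thesis by blast
qed

lemma quotient_map_quotient_topology: "quotient_map X (quotient_topology X f) f"
  by (simp add: quotient_map_def topspace_quotient_topology openin_quotient_topology)

text \<open>A space together with the set of its (relatively open) cells.\<close>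

type_synonym 'a cellulated = "'a topology \<times> 'a set set"

text \<open>Two points of a stratum lie on exactly the same members of \<open>A\<close>.  A stratum may be
  disconnected (e.g. the complement of all members of \<open>A\<close>), so the cells are the connected
  components of the strata.\<close>

definition stratum :: "'a topology \<Rightarrow> 'a set set \<Rightarrow> 'a set set \<Rightarrow> 'a set" where
  "stratum X A S = {p \<in> topspace X. {H \<in> A. p \<in> H} = S}"

definition cut_out_by :: "'a topology \<Rightarrow> 'a set set \<Rightarrow> 'a cellulated" where
  "cut_out_by X A =
     (X, \<Union>S \<in> Pow A. connected_components_of (subtopology X (stratum X A S)))"

definition same_cellulation :: "'a cellulated \<Rightarrow> 'b cellulated \<Rightarrow> bool" where
  "same_cellulation K L \<longleftrightarrow>
     (\<exists>f. homeomorphic_map (fst K) (fst L) f \<and> (\<lambda>c. f ` c) ` snd K = snd L)"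


section \<open>Configurations of symmetric pairs of particles\<close>

text \<open>A configuration of \<open>n\<close> labeled pairs \<open>{x\<^sub>i, -x\<^sub>i}\<close> is a vector in \<open>real ^ 'n\<close> with
  \<open>n = CARD('n)\<close>.  \<open>fixed\<close> refers to the presence of the fixed particle at the origin, \<open>free\<close>
  to its absence.\<close>

definition config_fixed :: "(real ^ 'n) set" where
  "config_fixed =
     UNIV - {x. (\<exists>i j. i \<noteq> j \<and> (x $ i = x $ j \<or> x $ i = - x $ j)) \<or> (\<exists>i. x $ i = 0)}"

definition config_free :: "(real ^ 'n) set" where
  "config_free = UNIV - {x. \<exists>i j. i \<noteq> j \<and> (x $ i = x $ j \<or> x $ i = - x $ j)}"

definition collisions_free :: "(real ^ 'n) set set" where
  "collisions_free =
     {{x. x $ i = x $ j} | i j. i \<noteq> j} \<union> {{x. x $ i = - x $ j} | i j. i \<noteq> j}"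

definition collisions_fixed :: "(real ^ 'n) set set" where
  "collisions_fixed = collisions_free \<union> {{x. x $ i = 0} | i. True}"

lemma Union_collisions_free:
  "\<Union>(collisions_free :: (real ^ 'n) set set) = {x. \<exists>i j. i \<noteq> j \<and> (x $ i = x $ j \<or> x $ i = - x $ j)}"
proof -
  have U: "\<Union>{F i j | i j. i \<noteq> j} = {x. \<exists>i j. i \<noteq> j \<and> x \<in> F i j}"
    for F :: "'n \<Rightarrow> 'n \<Rightarrow> (real ^ 'n) set" by blast
  show ?thesis
    unfolding collisions_free_def Union_Un_distrib U by auto
qed

lemma config_free_eq: "config_free = - \<Union>collisions_free"
  unfolding config_free_def Union_collisions_free by (rule Compl_eq_Diff_UNIV[symmetric])

lemma config_fixed_eq: "(config_fixed :: (real ^ 'n) set) = - \<Union>collisions_fixed"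
proof -
  have U: "\<Union>{F i | i. True} = {x. \<exists>i. x \<in> F i}" for F :: "'n \<Rightarrow> (real ^ 'n) set" by blast
  have "\<Union>(collisions_fixed :: (real ^ 'n) set set) =
      {x. (\<exists>i j. i \<noteq> j \<and> (x $ i = x $ j \<or> x $ i = - x $ j)) \<or> (\<exists>i. x $ i = (0::real))}"
    unfolding collisions_fixed_def Union_Un_distrib Union_collisions_free U by auto
  then show ?thesis
    unfolding config_fixed_def by (simp only: Compl_eq_Diff_UNIV)
qed

text \<open>The positive scalings of the line are closed under composition and inverses, so they are
  the group they generate.\<close>

definition Aff :: "(real \<Rightarrow> real) set" where
  "Aff = {\<lambda>t. c * t | c. c > 0}"

definition diagonal :: "(real \<Rightarrow> real) \<Rightarrow> real ^ 'n \<Rightarrow> real ^ 'n" where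
  "diagonal g x = (\<chi> i. g (x $ i))"

definition Aff_orbit :: "real ^ 'n \<Rightarrow> (real ^ 'n) set" where
  "Aff_orbit x = {diagonal g x | g. g \<in> Aff}"

text \<open>The configuration space \<open>C\<close> with the removed hyperplanes \<open>L\<close> put back, modulo \<open>Aff\<close>, and
  cellulated by the images of these hyperplanes.  The origin, where everything has collided, is
  not part of the space.\<close>

definition collided_points :: "(real ^ 'n) set \<Rightarrow> (real ^ 'n) set set \<Rightarrow> (real ^ 'n) set" where
  "collided_points C L = (C \<union> \<Union>L) - {0}"

definition collided :: "(real ^ 'n) set \<Rightarrow> (real ^ 'n) set set \<Rightarrow> (real ^ 'n) set cellulated" where
  "collided C L =
     cut_out_by (quotient_topology (top_of_set (collided_points C L)) Aff_orbit)
                ((\<lambda>H. Aff_orbit ` (H \<inter> collided_points C L)) ` L)"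

definition collided_fixed :: "(real ^ 'n) set cellulated" where
  "collided_fixed = collided config_fixed collisions_fixed"

definition collided_free :: "(real ^ 'n) set cellulated" where
  "collided_free = collided config_free collisions_free"

lemma collided_points_fixed: "collided_points config_fixed collisions_fixed = UNIV - {0}"
  by (auto simp: collided_points_def config_fixed_eq)

lemma collided_points_free: "collided_points config_free collisions_free = UNIV - {0}"
  by (auto simp: collided_points_def config_free_eq)


section \<open>Coxeter complexes\<close>

definition reflection :: "'a::euclidean_space \<Rightarrow> 'a \<Rightarrow> 'a" where
  "reflection a x = x - (2 * (a \<bullet> x) / (a \<bullet> a)) *\<^sub>R a"

definition reflecting_hyperplanes :: "('a::euclidean_space \<Rightarrow> 'a) set \<Rightarrow> 'a set set" where
  "reflecting_hyperplanes W = {{x. a \<bullet> x = 0} | a. a \<noteq> 0 \<and> reflection a \<in> W}"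

definition coxeter_complex :: "('a::euclidean_space \<Rightarrow> 'a) set \<Rightarrow> 'a cellulated" where
  "coxeter_complex W =
     cut_out_by (top_of_set (sphere 0 1)) ((\<lambda>H. H \<inter> sphere 0 1) ` reflecting_hyperplanes W)"

definition signed_perm :: "('n \<Rightarrow> 'n) \<Rightarrow> ('n \<Rightarrow> real) \<Rightarrow> real ^ 'n \<Rightarrow> real ^ 'n" where
  "signed_perm \<pi> s x = (\<chi> i. s i * x $ \<pi> i)"

text \<open>The groups of type \<open>B\<^sub>n\<close> and \<open>D\<^sub>n\<close> in their standard representation: all signed
  permutations of the coordinates, respectively those with an even number of sign changes.\<close>

definition coxeter_B :: "(real ^ 'n \<Rightarrow> real ^ 'n) set" where
  "coxeter_B = {signed_perm \<pi> s | \<pi> s. bij \<pi> \<and> (\<forall>i. s i = 1 \<or> s i = - 1)}"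

definition coxeter_D :: "(real ^ 'n \<Rightarrow> real ^ 'n) set" where
  "coxeter_D = {signed_perm \<pi> s | \<pi> s. bij \<pi> \<and> (\<forall>i. s i = 1 \<or> s i = - 1) \<and> (\<Prod>i\<in>UNIV. s i) = 1}"

text \<open>The reflecting hyperplanes of these groups are the expected ones.\<close>

lemma inner_axis_1: "axis i (1::real) \<bullet> x = x $ i"
  by (simp add: inner_axis inner_commute)

lemma axis_1_nth: "axis i (1::real) $ k = (if k = i then 1 else 0)"
  by (simp add: axis_def)

lemma reflection_axis:
  "reflection (axis i (1::real)) = signed_perm id (\<lambda>k. if k = i then - 1 else 1)"
  by (rule ext) (simp add: reflection_def signed_perm_def vec_eq_iff inner_axis_1 axis_1_nth)

lemma reflection_minus:
  assumes "i \<noteq> j"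
  shows "reflection (axis i (1::real) - axis j 1) = signed_perm (Transposition.transpose i j) (\<lambda>k. 1)"
  using assms
  by (intro ext)
     (auto simp: reflection_def signed_perm_def vec_eq_iff inner_axis_1 axis_1_nth inner_diff_left
        inner_diff_right Transposition.transpose_def field_simps)

lemma reflection_plus:
  assumes "i \<noteq> j"
  shows "reflection (axis i (1::real) + axis j 1) =
    signed_perm (Transposition.transpose i j) (\<lambda>k. if k = i \<or> k = j then - 1 else 1)"
  using assms
  by (intro ext)
     (auto simp: reflection_def signed_perm_def vec_eq_iff inner_axis_1 axis_1_nth inner_add_left
        inner_add_right Transposition.transpose_def field_simps)

lemma prod_one_sign: "(\<Prod>k\<in>UNIV. if k = (i::'n::finite) then - 1 else 1 :: real) = - 1"
  by simp

lemma prod_two_signs: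
  assumes "i \<noteq> j"
  shows "(\<Prod>k\<in>UNIV. if k = (i::'n::finite) \<or> k = j then - 1 else 1 :: real) = 1"
proof -
  have "(\<Prod>k\<in>UNIV. if k = i \<or> k = j then - 1 else 1 :: real) =
      (\<Prod>k\<in>UNIV. (if k = i then - 1 else 1) * (if k = j then - 1 else 1))"
    using assms by (intro prod.cong) auto
  then show ?thesis by (simp add: prod.distrib prod_one_sign)
qed

lemma reflection_signed_permD:
  fixes a :: "real ^ 'n"
  assumes refl: "reflection a = signed_perm \<pi> s" and a: "a \<noteq> 0"
    and s: "\<And>i. s i = 1 \<or> s i = - 1"
  shows "(\<exists>i. {x. a \<bullet> x = 0} = {x. x $ i = 0} \<and> (\<Prod>k\<in>UNIV. s k) = - 1) \<or>
         {x. a \<bullet> x = 0} \<in> collisions_free"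
proof -
  obtain i where i: "a $ i \<noteq> 0" using a by (auto simp: vec_eq_iff)
  define N where "N = a \<bullet> a"
  have N: "N \<noteq> 0" using a by (simp add: N_def)
  have E: "(if k = j then 1 else 0) - 2 * a $ j * a $ k / N = (if \<pi> k = j then s k else 0)" for k j
  proof -
    have "reflection a (axis j 1) $ k = signed_perm \<pi> s (axis j 1) $ k" by (simp add: refl)
    then show ?thesis
      by (simp add: reflection_def signed_perm_def N_def axis_1_nth inner_axis split: if_splits)
  qed
  show ?thesis
  proof (cases "\<pi> i = i")
    case True
    have z: "a $ j = 0" if "j \<noteq> i" for j
      using E[of i j] i N that True by auto
    have ax: "a \<bullet> x = a $ i * x $ i" for x
    proof -
      have "a \<bullet> x = (\<Sum>k\<in>UNIV. if k = i then a $ i * x $ i else 0)"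
        unfolding inner_vec_def by (intro sum.cong) (auto simp: z)
      then show ?thesis by simp
    qed
    have "s i = - 1" using E[of i i] True i by (simp add: N_def ax)
    moreover have "s k = 1" if "k \<noteq> i" for k
      using E[of k k] z[OF that] by (auto split: if_splits)
    ultimately have "(\<Prod>k\<in>UNIV. s k) = (\<Prod>k\<in>UNIV. if k = i then - 1 else 1)"
      by (intro prod.cong) auto
    then have "(\<Prod>k\<in>UNIV. s k) = - 1" by (simp add: prod_one_sign)
    moreover have "{x. a \<bullet> x = 0} = {x. x $ i = 0}" using i by (simp add: ax)
    ultimately show ?thesis by blast
  next
    case False
    define j where "j = \<pi> i"
    have j: "j \<noteq> i" using False by (simp add: j_def)
    have z: "a $ k = 0" if "k \<noteq> i" "k \<noteq> j" for k
      using E[of i k] i N that by (auto simp: j_def)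
    have Ni: "N = 2 * a $ i * a $ i" using E[of i i] j N by (simp add: j_def[symmetric] field_simps)
    have "- 2 * a $ j * a $ i = s i * N"
      using E[of i j] j N by (simp add: j_def[symmetric] field_simps)
    then have "a $ i * a $ j = a $ i * (- s i * a $ i)" by (simp add: Ni algebra_simps)
    then have aj: "a $ j = - s i * a $ i" using i by (simp only: mult_cancel_left simp_thms)
    have ax: "a \<bullet> x = a $ i * (x $ i - s i * x $ j)" for x
    proof -
      have "a \<bullet> x = (\<Sum>k\<in>UNIV. (if k = i then a $ i * x $ i else 0) + (if k = j then a $ j * x $ j else 0))"
        unfolding inner_vec_def using j by (intro sum.cong) (auto simp: z)
      then show ?thesis by (simp add: sum.distrib aj algebra_simps)
    qed
    have "{x. a \<bullet> x = 0} = {x. x $ i = s i * x $ j}" using i by (simp add: ax)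
    with s[of i] j have "{x. a \<bullet> x = 0} \<in> collisions_free"
      unfolding collisions_free_def by force
    then show ?thesis ..
  qed
qed

lemma collisions_free_reflecting:
  assumes "H \<in> (collisions_free :: (real ^ 'n) set set)"
  shows "H \<in> reflecting_hyperplanes coxeter_D"
proof -
  from assms obtain i j where ij: "i \<noteq> j"
    and H: "H = {x. x $ i = x $ j} \<or> H = {x. x $ i = - x $ j}"
    unfolding collisions_free_def by blast
  have nz: "axis i (1::real) - axis j 1 \<noteq> 0" "axis i (1::real) + axis j 1 \<noteq> 0"
    using ij by (auto simp: vec_eq_iff inner_axis_1 axis_1_nth)
  have "reflection (axis i (1::real) - axis j 1) \<in> coxeter_D"
    unfolding coxeter_D_def reflection_minus[OF ij] by force
  moreover have "reflection (axis i (1::real) + axis j 1) \<in> coxeter_D"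
    unfolding coxeter_D_def reflection_plus[OF ij] using prod_two_signs[OF ij] by force
  moreover have "{x. (axis i (1::real) - axis j 1) \<bullet> x = 0} = {x. x $ i = x $ j}"
    "{x. (axis i (1::real) + axis j 1) \<bullet> x = 0} = {x. x $ i = - x $ j}"
    by (auto simp: inner_diff_left inner_add_left inner_axis_1)
  ultimately show ?thesis
    using H nz unfolding reflecting_hyperplanes_def by blast
qed

lemma reflecting_hyperplanes_D:
  "reflecting_hyperplanes coxeter_D = (collisions_free :: (real ^ 'n) set set)"
proof
  show "reflecting_hyperplanes coxeter_D \<subseteq> (collisions_free :: (real ^ 'n) set set)"
  proof
    fix H :: "(real ^ 'n) set" assume "H \<in> reflecting_hyperplanes coxeter_D"
    then obtain a \<pi> s where "H = {x. a \<bullet> x = 0}" "a \<noteq> 0" "reflection a = signed_perm \<pi> s"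
      "\<And>i. s i = 1 \<or> s i = - 1" "(\<Prod>i\<in>UNIV. s i) = 1"
      unfolding reflecting_hyperplanes_def coxeter_D_def by blast
    then show "H \<in> collisions_free" using reflection_signed_permD[of a \<pi> s] by auto
  qed
qed (use collisions_free_reflecting in blast)

lemma reflecting_hyperplanes_B:
  "reflecting_hyperplanes coxeter_B = (collisions_fixed :: (real ^ 'n) set set)"
proof
  show "reflecting_hyperplanes coxeter_B \<subseteq> (collisions_fixed :: (real ^ 'n) set set)"
  proof
    fix H :: "(real ^ 'n) set" assume "H \<in> reflecting_hyperplanes coxeter_B"
    then obtain a \<pi> s where "H = {x. a \<bullet> x = 0}" "a \<noteq> 0" "reflection a = signed_perm \<pi> s"
      "\<And>i. s i = 1 \<or> s i = - 1"
      unfolding reflecting_hyperplanes_def coxeter_B_def by blast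
    then show "H \<in> collisions_fixed"
      using reflection_signed_permD[of a \<pi> s] unfolding collisions_fixed_def by auto
  qed
  have "coxeter_D \<subseteq> (coxeter_B :: (real ^ 'n \<Rightarrow> real ^ 'n) set)"
    unfolding coxeter_B_def coxeter_D_def by blast
  then have "collisions_free \<subseteq> reflecting_hyperplanes (coxeter_B :: (real ^ 'n \<Rightarrow> real ^ 'n) set)"
    using collisions_free_reflecting unfolding reflecting_hyperplanes_def by blast
  moreover have "{x. x $ i = 0} \<in> reflecting_hyperplanes (coxeter_B :: (real ^ 'n \<Rightarrow> real ^ 'n) set)"
    for i
  proof -
    have "reflection (axis i (1::real)) \<in> coxeter_B"
      unfolding coxeter_B_def reflection_axis by force
    moreover have "axis i (1::real) \<noteq> 0" by (auto simp: vec_eq_iff inner_axis_1 axis_1_nth)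
    moreover have "{x. axis i (1::real) \<bullet> x = 0} = {x. x $ i = 0}" by (simp add: inner_axis_1)
    ultimately show ?thesis unfolding reflecting_hyperplanes_def by blast
  qed
  ultimately show "(collisions_fixed :: (real ^ 'n) set set) \<subseteq> reflecting_hyperplanes coxeter_B"
    unfolding collisions_fixed_def by blast
qed

end

theory Submission
  imports Defs
begin

text \<open>Positive scalings of the line act diagonally as positive scalings of the vector space, so a
  configuration other than the origin has exactly one unit vector in its orbit, namely its
  normalisation \<^const>\<open>sgn\<close>.  Normalisation is continuous and constant on orbits, hence descends to
  a continuous map from the orbit space to the unit sphere; its inverse sends a unit vector to its
  orbit, and is continuous because the projection to the orbit space is
  (\<open>orbit_space_homeomorphic_sphere\<close>).

  The collision loci are unions of rays and, away from the origin, a cone is recovered from its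
  unit vectors: normalisation carries the image of a collision locus in the orbit space onto its
  trace on the sphere.  The cells are defined from the topology and the family of distinguished
  subsets alone, so a homeomorphism matching these subsets also matches the cells
  (\<open>same_cellulation_cut_out_by\<close>).  It remains that the collision loci are precisely the
  reflecting hyperplanes of the two Coxeter groups, which is \<open>reflecting_hyperplanes_B\<close> and
  \<open>reflecting_hyperplanes_D\<close>.\<close>

lemma image_stratum:
  assumes f: "homeomorphic_map X Y f" and A: "A \<subseteq> Pow (topspace X)" and S: "S \<subseteq> A"
  shows "f ` stratum X A S = stratum Y (image f ` A) (image f ` S)"
proof -
  have inj: "inj_on f (topspace X)" and surj: "f ` topspace X = topspace Y"
    using f by (auto simp: homeomorphic_eq_everything_map)
  have mem: "f p \<in> f ` H \<longleftrightarrow> p \<in> H" if "p \<in> topspace X" "H \<in> A" for p H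
    using inj that A by (meson PowD inj_on_image_mem_iff subsetD)
  have inj_image: "inj_on (image f) A"
    using inj A by (meson inj_on_image_Pow inj_on_subset)
  have "{H' \<in> image f ` A. f p \<in> H'} = image f ` S \<longleftrightarrow> {H \<in> A. p \<in> H} = S"
    if p: "p \<in> topspace X" for p
  proof -
    have "{H' \<in> image f ` A. f p \<in> H'} = image f ` {H \<in> A. p \<in> H}"
      using mem[OF p] by auto
    then show ?thesis
      using inj_on_image_eq_iff[OF inj_image, of "{H \<in> A. p \<in> H}" S] S by auto
  qed
  then show ?thesis
    unfolding stratum_def surj[symmetric] by auto
qed

text \<open>Every ingredient of a cell (incidence with the distinguished subsets, connected components)
  is transported by a homeomorphism.  The distinguished subsets have to lie in the space, since
  otherwise their images under \<open>f\<close> could contain unrelated points.\<close>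

lemma same_cellulation_cut_out_by:
  assumes f: "homeomorphic_map X Y f" and A: "A \<subseteq> Pow (topspace X)"
  shows "same_cellulation (cut_out_by X A) (cut_out_by Y (image f ` A))"
proof -
  have comps: "connected_components_of (subtopology Y (stratum Y (image f ` A) (image f ` S))) =
      image f ` connected_components_of (subtopology X (stratum X A S))" if "S \<in> Pow A" for S
  proof -
    have "stratum X A S \<subseteq> topspace X" "stratum Y B T \<subseteq> topspace Y" for B T
      by (auto simp: stratum_def)
    then have "homeomorphic_map (subtopology X (stratum X A S))
        (subtopology Y (stratum Y (image f ` A) (image f ` S))) f"
      using that by (intro homeomorphic_map_subtopologies f)
        (simp add: image_stratum[OF f A] Int_absorb1)
    then show ?thesis
      by (rule homeomorphic_map_connected_components_of)
  qed
  have "Pow (image f ` A) = image (image f) ` Pow A"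
    by (simp add: image_Pow_surj)
  then have "snd (cut_out_by Y (image f ` A)) = image f ` snd (cut_out_by X A)"
    by (simp add: cut_out_by_def comps image_UN)
  with f show ?thesis
    unfolding same_cellulation_def by (auto simp: cut_out_by_def)
qed

lemma Aff_orbit_eq: "Aff_orbit x = {c *\<^sub>R x | c. c > 0}"
proof -
  have "diagonal (\<lambda>t. c * t) x = c *\<^sub>R x" for c
    by (simp add: diagonal_def vec_eq_iff)
  then show ?thesis
    unfolding Aff_orbit_def Aff_def by (auto; metis)
qed

lemma Aff_orbit_scaleR:
  assumes "c > 0"
  shows "Aff_orbit (c *\<^sub>R x) = Aff_orbit x"
proof -
  have "\<exists>b. d *\<^sub>R x = b *\<^sub>R c *\<^sub>R x \<and> b > 0" if "d > 0" for d
    using assms that by (intro exI[of _ "d / c"]) simp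
  then show ?thesis
    using assms by (auto simp: Aff_orbit_eq intro: mult_pos_pos)
qed

lemma sgn_eq_if_Aff_orbit_eq:
  assumes "Aff_orbit x = Aff_orbit y"
  shows "sgn x = sgn y"
proof -
  have "x \<in> Aff_orbit x"
    unfolding Aff_orbit_eq by (auto intro: exI[of _ "1::real"])
  then obtain c where "x = c *\<^sub>R y" "c > 0"
    unfolding assms by (auto simp: Aff_orbit_eq)
  then show ?thesis
    by (simp add: sgn_scaleR)
qed

lemma Aff_orbit_sgn:
  assumes "x \<noteq> 0"
  shows "Aff_orbit (sgn x) = Aff_orbit x"
  using assms by (simp add: sgn_div_norm Aff_orbit_scaleR)

lemma orbit_space_homeomorphic_sphere:
  obtains f :: "(real ^ 'n) set \<Rightarrow> real ^ 'n" where
    "homeomorphic_map (quotient_topology (top_of_set (UNIV - {0})) Aff_orbit)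
       (top_of_set (sphere 0 1)) f"
    "\<And>x. x \<noteq> 0 \<Longrightarrow> f (Aff_orbit x) = sgn x"
proof -
  let ?X = "top_of_set (UNIV - {0::real ^ 'n})"
  let ?Q = "quotient_topology ?X Aff_orbit"
  let ?S = "top_of_set (sphere (0::real ^ 'n) 1)"
  have quot: "quotient_map ?X ?Q Aff_orbit"
    by (rule quotient_map_quotient_topology)
  have sgn: "continuous_map ?X ?S sgn"
    by (simp add: norm_sgn sgn_div_norm image_subset_iff continuous_on_inverse continuous_on_norm
        continuous_on_scaleR continuous_on_id)
  obtain f where f: "continuous_map ?Q ?S f"
    and f_orbit: "\<And>x. x \<in> topspace ?X \<Longrightarrow> f (Aff_orbit x) = sgn x"
  proof (rule quotient_map_lift_exists[OF quot sgn])
    show "sgn x = sgn y" if "Aff_orbit x = Aff_orbit y" for x y :: "real ^ 'n"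
      using that by (rule sgn_eq_if_Aff_orbit_eq)
  qed (rule that)
  have "continuous_map ?S ?X id"
    by auto
  then have "continuous_map ?S ?Q (Aff_orbit \<circ> id)"
    using quotient_imp_continuous_map[OF quot] by (rule continuous_map_compose)
  moreover have "f (Aff_orbit y) = y" if "norm y = 1" for y
  proof -
    have "y \<noteq> 0" "sgn y = y"
      using that by (auto simp: sgn_div_norm)
    then show ?thesis
      using f_orbit[of y] by simp
  qed
  ultimately have "homeomorphic_maps ?Q ?S f Aff_orbit"
    using f f_orbit
    by (auto simp: homeomorphic_maps_def topspace_quotient_topology Aff_orbit_sgn)
  then have "homeomorphic_map ?Q ?S f"
    unfolding homeomorphic_map_maps by blast
  then show ?thesis
    by (rule that) (simp add: f_orbit)
qed

text \<open>Away from the origin, normalising a cone does not leave it, and fixes its unit vectors.\<close>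

lemma sgn_image_cone:
  fixes H :: "'a::real_normed_vector set"
  assumes "\<And>c x. c > 0 \<Longrightarrow> x \<in> H \<Longrightarrow> c *\<^sub>R x \<in> H"
  shows "sgn ` (H - {0}) = H \<inter> sphere 0 1"
proof (intro equalityI subsetI)
  fix y assume "y \<in> sgn ` (H - {0})"
  then show "y \<in> H \<inter> sphere 0 1"
    using assms by (auto simp: norm_sgn sgn_div_norm)
next
  fix y assume "y \<in> H \<inter> sphere 0 1"
  then show "y \<in> sgn ` (H - {0})"
    by (intro image_eqI[of _ _ y]) (auto simp: sgn_div_norm)
qed

lemma same_cellulation_collided_sphere:
  fixes C :: "(real ^ 'n) set"
  assumes points: "collided_points C L = UNIV - {0}"
    and cone: "\<And>H c x. H \<in> L \<Longrightarrow> c > 0 \<Longrightarrow> x \<in> H \<Longrightarrow> c *\<^sub>R x \<in> H"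
  shows "same_cellulation (collided C L)
           (cut_out_by (top_of_set (sphere 0 1)) ((\<lambda>H. H \<inter> sphere 0 1) ` L))"
proof -
  obtain f :: "(real ^ 'n) set \<Rightarrow> real ^ 'n"
    where f: "homeomorphic_map (quotient_topology (top_of_set (UNIV - {0})) Aff_orbit)
       (top_of_set (sphere 0 1)) f"
    and f_orbit: "\<And>x. x \<noteq> 0 \<Longrightarrow> f (Aff_orbit x) = sgn x"
    using orbit_space_homeomorphic_sphere by blast
  have "f ` Aff_orbit ` (H \<inter> (UNIV - {0})) = H \<inter> sphere 0 1" if "H \<in> L" for H
  proof -
    have "f ` Aff_orbit ` (H \<inter> (UNIV - {0})) = sgn ` (H - {0})"
      unfolding image_image by (intro image_cong) (auto simp: f_orbit)
    then show ?thesis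
      using cone[OF that] by (simp only: sgn_image_cone)
  qed
  then have "image f ` (\<lambda>H. Aff_orbit ` (H \<inter> (UNIV - {0}))) ` L = (\<lambda>H. H \<inter> sphere 0 1) ` L"
    unfolding image_image by (intro image_cong) auto
  moreover have loci: "(\<lambda>H. Aff_orbit ` (H \<inter> (UNIV - {0}))) ` L
      \<subseteq> Pow (topspace (quotient_topology (top_of_set (UNIV - {0})) Aff_orbit))"
    by (auto simp: topspace_quotient_topology)
  ultimately show ?thesis
    unfolding collided_def points using same_cellulation_cut_out_by[OF f loci] by simp
qed

lemma collisions_fixed_cone:
  assumes "H \<in> collisions_fixed" "x \<in> H"
  shows "c *\<^sub>R x \<in> H"
  using assms unfolding collisions_fixed_def collisions_free_def by auto

theorem proposition3p5:
  shows "same_cellulation (collided_fixed :: (real ^ 'n) set cellulated)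
           (coxeter_complex (coxeter_B :: (real ^ 'n \<Rightarrow> real ^ 'n) set)) \<and>
         same_cellulation (collided_free :: (real ^ 'n) set cellulated)
           (coxeter_complex (coxeter_D :: (real ^ 'n \<Rightarrow> real ^ 'n) set))"
proof
  show "same_cellulation (collided_fixed :: (real ^ 'n) set cellulated)
      (coxeter_complex (coxeter_B :: (real ^ 'n \<Rightarrow> real ^ 'n) set))"
    unfolding collided_fixed_def coxeter_complex_def reflecting_hyperplanes_B
    by (intro same_cellulation_collided_sphere collided_points_fixed collisions_fixed_cone)
  have "(collisions_free :: (real ^ 'n) set set) \<subseteq> collisions_fixed"
    by (simp add: collisions_fixed_def)
  then show "same_cellulation (collided_free :: (real ^ 'n) set cellulated)
      (coxeter_complex (coxeter_D :: (real ^ 'n \<Rightarrow> real ^ 'n) set))"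
    unfolding collided_free_def coxeter_complex_def reflecting_hyperplanes_D
    by (intro same_cellulation_collided_sphere collided_points_free collisions_fixed_cone) auto
qed

end
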